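(* Let $k\in\mathbb{N}$, $0<\tau\le 1$, $0<\mu\le 1$, $0\le\tau-\mu<1$, $0\le\delta<1$, $0\le\gamma<1$, $\tau-\mu+\gamma<1$, and let $0\le\alpha<1$. If $f\in\mathcal{P}_{\tau,\mu}(k,\delta,\gamma)$, then $f$ is convex of order $\alpha$ in the disk $|z|<r_3$, i.e. $\Re\big(1+zf''(z)/f'(z)\big)>\alpha$ for all $|z|<r_3$, where $$r_3:=\inf_{\nu\ge k+1}\left\{\frac{(1-\alpha)(1+\delta\nu-\delta)\,\Gamma(\nu+\tau)\Gamma(\mu+1)}{\nu(\nu-\alpha)(1-\gamma)\,\Gamma(\nu+\mu)\Gamma(\tau+1)}\right\}^{1/(\nu-1)},$$ the infimum being over integers $\nu\ge k+1$.
   Context: $\mathbb{U}=\{z\in\mathbb{C}:|z|<1\}$, $\mathbb{N}=\{1,2,3,\dots\}$. For $k\in\mathbb{N}$, $\mathcal{P}(k)$ is the class of functions that are analytic and univalent in $\mathbb{U}$ and of the form $f(z)=z-\sum_{\nu=k+1}^{\infty}a_\nu z^\nu$ with all $a_\nu\ge 0$. Srivastava-Owa fractional derivative: for $0\le\varsigma<1$, $\mathfrak{D}_z^{\varsigma}g(z)=\frac{1}{\Gamma(1-\varsigma)}\frac{d}{dz}\int_0^z g(\zeta)(z-\zeta)^{-\varsigma}\,d\zeta$, where the multiplicity of $(z-\zeta)^{-\varsigma}$ is removed by requiring $\log(z-\zeta)$ to be real when $z-\zeta>0$. Tremblay operator: for $0<\tau\le 1$, $0<\mu\le 1$, $0\le\tau-\mu<1$,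 $\mathfrak{T}^{\tau,\mu}f(z)=\frac{\Gamma(\mu)}{\Gamma(\tau)}z^{1-\mu}\,\mathfrak{D}_z^{\tau-\mu}\big[z^{\tau-1}f(z)\big]$ for $z\in\mathbb{U}$. (Powers of $z$ and $\zeta$ are taken with the principal branch and the integral along the segment from $0$ to $z$; the resulting function is understood as extended analytically to all of $\mathbb{U}$, including $z=0$ and the negative real axis.) Class $\mathcal{P}_{\tau,\mu}(k,\delta,\gamma)$ (with $0<\tau\le1$, $0<\mu\le1$, $0\le\tau-\mu<1$, $0\le\delta<1$, $0\le\gamma<1$, $\tau-\mu+\gamma<1$): the set of $f\in\mathcal{P}(k)$ such that for all $z\in\mathbb{U}$ $$\Re\left(\frac{\Gamma(\mu+1)\Gamma(\tau)}{\Gamma(\tau+1)\Gamma(\mu)}z^{-1}\left[(1-\delta)\mathfrak{T}^{\tau,\mu}f(z)+\delta z\big(\mathfrak{T}^{\tau,\mu}f\big)'(z)\right]\right)>\gamma,$$ the value at $z=0$ being understood by removing the singularity. *)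

theory Defs
  imports "HOL-Complex_Analysis.Complex_Analysis"
begin

definition class_P :: "nat \<Rightarrow> (complex \<Rightarrow> complex) set" where
  "class_P k = {f. f analytic_on ball 0 1 \<and> inj_on f (ball 0 1) \<and>
     (\<exists>a :: nat \<Rightarrow> real. (\<forall>\<nu>\<ge>k+1. a \<nu> \<ge> 0) \<and>
       (\<forall>z\<in>ball 0 1. (\<lambda>n. of_real (a (n + (k+1))) * z ^ (n + (k+1))) sums (z - f z)))}"

text \<open>The Srivastava-Owa fractional derivative, with the integral taken along the segment from
  0 to \<open>z\<close>. The principal branch of \<open>powr\<close> makes \<open>log (z - \<zeta>)\<close> real for \<open>z - \<zeta> > 0\<close>.\<close>

definition frac_deriv :: "real \<Rightarrow> (complex \<Rightarrow> complex) \<Rightarrow> complex \<Rightarrow> complex" where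
  "frac_deriv s g z = 1 / of_real (Gamma (1 - s)) *
     deriv (\<lambda>w. contour_integral (linepath 0 w) (\<lambda>\<zeta>. g \<zeta> * (w - \<zeta>) powr of_real (- s))) z"

definition tremblay_formula ::
    "real \<Rightarrow> real \<Rightarrow> (complex \<Rightarrow> complex) \<Rightarrow> complex \<Rightarrow> complex" where
  "tremblay_formula \<tau> \<mu> f z = of_real (Gamma \<mu> / Gamma \<tau>) * z powr of_real (1 - \<mu>) *
     frac_deriv (\<tau> - \<mu>) (\<lambda>\<zeta>. \<zeta> powr of_real (\<tau> - 1) * f \<zeta>) z"

text \<open>The principal powers of \<open>z\<close> jump across the non-positive real axis, so the formula is
  meaningful only on the slit disc. The Tremblay operator is its analytic extension to the whole
  disc; by the lemma below, the extension is unique there. Values outside the unit disc are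
  irrelevant.\<close>

definition analytic_extension :: "(complex \<Rightarrow> complex) \<Rightarrow> (complex \<Rightarrow> complex) \<Rightarrow> bool" where
  "analytic_extension g h \<longleftrightarrow>
     h analytic_on ball 0 1 \<and> (\<forall>z\<in>ball 0 1 - \<real>\<^sub>\<le>\<^sub>0. h z = g z)"

definition tremblay :: "real \<Rightarrow> real \<Rightarrow> (complex \<Rightarrow> complex) \<Rightarrow> complex \<Rightarrow> complex" where
  "tremblay \<tau> \<mu> f = (SOME h. analytic_extension (tremblay_formula \<tau> \<mu> f) h)"

lemma analytic_extension_unique:
  assumes "analytic_extension g h1" "analytic_extension g h2" "z \<in> ball 0 1"
  shows "h1 z = h2 z"
proof (rule analytic_continuation_open[of "ball 0 1 - \<real>\<^sub>\<le>\<^sub>0" "ball 0 1" h1 h2])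
  show "open (ball 0 1 - \<real>\<^sub>\<le>\<^sub>0 :: complex set)"
    by (intro open_Diff) auto
  have "(1/2 :: complex) \<in> ball 0 1 - \<real>\<^sub>\<le>\<^sub>0"
    by (auto simp: complex_nonpos_Reals_iff)
  then show "ball 0 1 - \<real>\<^sub>\<le>\<^sub>0 \<noteq> ({} :: complex set)"
    by blast
qed (use assms in \<open>auto simp: analytic_extension_def analytic_on_open\<close>)

text \<open>\<open>remove_sings\<close> supplies the limit as value at \<open>z = 0\<close> and does not change the values at the
  other points of the disc, where the function is analytic.\<close>

definition class_P_tremblay ::
    "real \<Rightarrow> real \<Rightarrow> nat \<Rightarrow> real \<Rightarrow> real \<Rightarrow> (complex \<Rightarrow> complex) set" where
  "class_P_tremblay \<tau> \<mu> k \<delta> \<gamma> = {f \<in> class_P k. \<forall>z\<in>ball 0 1.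
     Re (remove_sings (\<lambda>w. of_real (Gamma (\<mu> + 1) * Gamma \<tau> / (Gamma (\<tau> + 1) * Gamma \<mu>)) *
           inverse w * (of_real (1 - \<delta>) * tremblay \<tau> \<mu> f w +
                        of_real \<delta> * w * deriv (tremblay \<tau> \<mu> f) w)) z) > \<gamma>}"

text \<open>Since division by zero yields zero, the quotient needs the side condition
  \<open>deriv f z \<noteq> 0\<close> to be meaningful.\<close>

definition convex_of_order_in_disc :: "real \<Rightarrow> real \<Rightarrow> (complex \<Rightarrow> complex) \<Rightarrow> bool" where
  "convex_of_order_in_disc \<alpha> r f \<longleftrightarrow> (\<forall>z. norm z < r \<longrightarrow>
     deriv f z \<noteq> 0 \<and> Re (1 + z * deriv (deriv f) z / deriv f z) > \<alpha>)"

text \<open>The terms tend to 1 as \<open>\<nu>\<close> tends to infinity, so the radius is at most 1 and the disc lies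
  within the unit disc.\<close>

definition radius_r3 ::
    "real \<Rightarrow> real \<Rightarrow> nat \<Rightarrow> real \<Rightarrow> real \<Rightarrow> real \<Rightarrow> real" where
  "radius_r3 \<tau> \<mu> k \<delta> \<gamma> \<alpha> = (INF \<nu>\<in>{k+1..}.
     ((1 - \<alpha>) * (1 + \<delta> * real \<nu> - \<delta>) * Gamma (real \<nu> + \<tau>) * Gamma (\<mu> + 1) /
      (real \<nu> * (real \<nu> - \<alpha>) * (1 - \<gamma>) * Gamma (real \<nu> + \<mu>) * Gamma (\<tau> + 1)))
     powr (1 / (real \<nu> - 1)))"

end

theory Submission imports Defs begin

text \<open>Since \<open>\<integral>\<^sub>0\<^sup>1 t\<^bsup>p-1\<^esup> (1-t)\<^bsup>q-1\<^esup> dt\<close> is a Beta value, the Tremblay operator multiplies the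
  coefficient of \<open>z\<^sup>n\<close> by \<open>\<Gamma>(\<mu>) \<Gamma>(n+\<tau>) / (\<Gamma>(\<tau>) \<Gamma>(n+\<mu>))\<close>. Letting a real argument tend to 1 in the
  condition that defines the class turns it into the coefficient inequality
  \<open>\<Sum> a\<^sub>n (1 + \<delta>n - \<delta>) \<Gamma>(n+\<tau>) \<Gamma>(\<mu>+1) / (\<Gamma>(n+\<mu>) \<Gamma>(\<tau>+1)) \<le> 1 - \<gamma>\<close>. The radius is chosen such that, for
  \<open>|z| < r\<^sub>3\<close>, this inequality implies \<open>\<Sum> n (n-\<alpha>) a\<^sub>n |z|\<^bsup>n-1\<^esup> < 1 - \<alpha>\<close>, which bounds
  \<open>|z f''(z) / f'(z)|\<close> by \<open>1 - \<alpha>\<close>.\<close>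

section \<open>Power series in the unit disc\<close>

lemma powser_abs_summable_in_unit_disc:
  fixes b :: "nat \<Rightarrow> complex"
  assumes "\<And>z. norm z < 1 \<Longrightarrow> (\<lambda>n. b n * z ^ n) sums f z" and "norm w < 1"
  shows "summable (\<lambda>n. norm (b n * w ^ n))"
proof -
  obtain r where r: "norm w < r" "r < 1"
    using assms(2) dense by blast
  then have "r > 0"
    using norm_ge_zero[of w] by linarith
  with r show ?thesis
    by (intro powser_insidea[of b "of_real r"] sums_summable[OF assms(1)]) auto
qed

text \<open>Multiplying the derivative by \<open>z\<close> keeps the exponents aligned, so the
  operator is diagonal on coefficients and can be iterated and combined with other series
  termwise.\<close>

lemma powser_times_deriv:
  fixes b :: "nat \<Rightarrow> complex"
  assumes f: "\<And>z. norm z < 1 \<Longrightarrow> (\<lambda>n. b n * z ^ n) sums f z" and z: "norm z < 1"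
  shows "(\<lambda>n. of_nat n * b n * z ^ n) sums (z * deriv f z)"
proof -
  have "f holomorphic_on ball 0 1"
    using f by (intro power_series_holomorphic[of 0 1 b]) auto
  then have "(f has_field_derivative deriv f z) (at z)"
    using z by (intro holomorphic_derivI) auto
  from termdiffs_sums_strong[OF f this z]
  have "(\<lambda>n. diffs b n * z ^ n) sums deriv f z" .
  then have "(\<lambda>n. z * (diffs b n * z ^ n)) sums (z * deriv f z)"
    by (rule sums_mult)
  then have "(\<lambda>n. of_nat (Suc n) * b (Suc n) * z ^ Suc n) sums (z * deriv f z)"
    by (simp add: diffs_def mult_ac)
  \<comment> \<open>The factor \<open>of_nat n\<close> kills the term of index 0, so the index shift
    adds nothing.\<close>
  then show ?thesis
    by (subst (asm) sums_Suc_iff) simp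
qed

section \<open>Action of the Tremblay operator on power series\<close>

text \<open>Termwise integration by dominated convergence: on the unit interval the partial sums are
  bounded by \<open>\<beta> t * M\<close>, where \<open>M\<close> sums the norms of the terms at
  \<open>w\<close>. Integrability is recorded separately because the contour integral below relies
  on it.\<close>

lemma beta_integral_powser:
  fixes b :: "nat \<Rightarrow> complex" and p q :: real
  defines "\<beta> \<equiv> \<lambda>t. t powr (p - 1) * (1 - t) powr (q - 1)"
  assumes "p > 0" "q > 0" and f: "\<And>z. norm z < 1 \<Longrightarrow> (\<lambda>n. b n * z ^ n) sums f z"
    and w: "norm w < 1"
  shows "(\<lambda>t. of_real (\<beta> t) * f (of_real t * w)) integrable_on {0..1}"
    and "(\<lambda>n. b n * of_real (Beta (p + real n) q) * w ^ n) sums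
           integral {0..1} (\<lambda>t. of_real (\<beta> t) * f (of_real t * w))"
proof -
  define F where "F m t = (\<Sum>n<m. of_real (\<beta> t) * (b n * (of_real t * w) ^ n))" for m and t :: real
  have term_int: "((\<lambda>t. of_real (\<beta> t) * (b n * (of_real t * w) ^ n)) has_integral
           b n * of_real (Beta (p + real n) q) * w ^ n) {0..1}" for n
  proof -
    have "((\<lambda>t. b n * w ^ n * of_real (t powr (p + real n - 1) * (1 - t) powr (q - 1)))
            has_integral b n * w ^ n * of_real (Beta (p + real n) q)) {0..1}"
      by (intro has_integral_mult_right has_integral_of_real has_integral_Beta_real)
         (use assms in auto)
    moreover have "b n * w ^ n * of_real (t powr (p + real n - 1) * (1 - t) powr (q - 1)) =
        of_real (\<beta> t) * (b n * (of_real t * w) ^ n)" if "t \<in> {0..1}" for t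
    \<comment> \<open>The power is split for positive \<open>t\<close>; at \<open>t = 0\<close> both
      sides vanish because \<open>0 powr x = 0\<close>.\<close>
    proof (cases "t = 0")
      case False
      with that have "t powr (p + real n - 1) = t powr (p - 1) * t ^ n"
        by (simp add: powr_add powr_diff powr_realpow)
      then show ?thesis
        by (simp add: \<beta>_def power_mult_distrib)
    qed (simp add: \<beta>_def)
    ultimately show ?thesis
      by (subst has_integral_cong[symmetric]) (auto simp: mult_ac)
  qed
  have F_int: "(F m has_integral (\<Sum>n<m. b n * of_real (Beta (p + real n) q) * w ^ n)) {0..1}" for m
    unfolding F_def by (intro has_integral_sum term_int) auto
  define M where "M = (\<Sum>n. norm (b n * w ^ n))"
  have dom_int: "(\<lambda>t. \<beta> t * M) integrable_on {0..1}"
    using has_integral_Beta_real[of p q] assms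
    by (intro integrable_on_mult_left) (auto simp: integrable_on_def)
  have bound: "norm (F m t) \<le> \<beta> t * M" if t: "t \<in> {0..1}" for m t
  proof -
    have "norm (\<Sum>n<m. b n * (of_real t * w) ^ n) \<le> (\<Sum>n<m. norm (b n * w ^ n))"
    proof (rule sum_norm_le)
      fix n
      have "t ^ n \<le> 1"
        using t by (simp add: power_le_one)
      then have "norm (b n * w ^ n) * t ^ n \<le> norm (b n * w ^ n)"
        by (simp add: mult_left_le)
      then show "norm (b n * (of_real t * w) ^ n) \<le> norm (b n * w ^ n)"
        using t by (simp add: norm_mult norm_power power_mult_distrib mult_ac)
    qed
    also have "\<dots> \<le> M"
      unfolding M_def
      by (intro sum_le_suminf powser_abs_summable_in_unit_disc[OF f w]) auto
    finally have "norm (\<Sum>n<m. b n * (of_real t * w) ^ n) \<le> M" .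
    moreover have "\<beta> t \<ge> 0"
      by (simp add: \<beta>_def)
    ultimately show ?thesis
      by (simp add: F_def norm_mult mult_left_mono flip: sum_distrib_left)
  qed
  have lim: "(\<lambda>m. F m t) \<longlonglongrightarrow> of_real (\<beta> t) * f (of_real t * w)" if t: "t \<in> {0..1}" for t
  proof -
    have "norm (of_real t * w) \<le> norm w"
      using t by (auto simp: norm_mult intro: mult_left_le_one_le)
    with w have "norm (of_real t * w) < 1"
      by linarith
    from sums_mult[OF f[OF this]] show ?thesis
      by (simp add: F_def sums_def)
  qed
  show "(\<lambda>t. of_real (\<beta> t) * f (of_real t * w)) integrable_on {0..1}"
    by (rule dominated_convergence[OF has_integral_integrable[OF F_int] dom_int bound lim])
  have "(\<lambda>m. integral {0..1} (F m)) \<longlonglongrightarrow> integral {0..1} (\<lambda>t. of_real (\<beta> t) * f (of_real t * w))"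
    by (rule dominated_convergence[OF has_integral_integrable[OF F_int] dom_int bound lim])
  then show "(\<lambda>n. b n * of_real (Beta (p + real n) q) * w ^ n) sums
           integral {0..1} (\<lambda>t. of_real (\<beta> t) * f (of_real t * w))"
    by (simp add: sums_def integral_unique[OF F_int])
qed

text \<open>Substitution of \<open>t * w\<close> for \<open>\<zeta>\<close> on the segment. The
  factors \<open>t\<close> and \<open>1 - t\<close> are nonnegative reals, so the principal powers
  split without a branch correction, and the formula holds on the negative axis as well.\<close>

lemma contour_integral_fractional:
  fixes p q :: real
  assumes "w \<noteq> 0"
    and int: "(\<lambda>t. of_real (t powr (p - 1) * (1 - t) powr (q - 1)) * f (of_real t * w))
           integrable_on {0..1}"
  shows "contour_integral (linepath 0 w)
           (\<lambda>\<zeta>. \<zeta> powr of_real (p - 1) * f \<zeta> * (w - \<zeta>) powr of_real (q - 1)) =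
         w powr of_real (p + q - 1) *
           integral {0..1} (\<lambda>t. of_real (t powr (p - 1) * (1 - t) powr (q - 1)) * f (of_real t * w))"
    (is "contour_integral _ ?g = ?c * integral _ ?h")
proof -
  have "(?g has_contour_integral ?c * integral {0..1} ?h) (linepath 0 w)"
    unfolding has_contour_integral_linepath
  proof (rule has_integral_eq[rotated])
    show "((\<lambda>t. ?c * ?h t) has_integral ?c * integral {0..1} ?h) {0..1}"
      using int by (intro has_integral_mult_right integrable_integral)
    fix t :: real
    assume t: "t \<in> {0..1}"
    have pw: "(of_real u * w) powr of_real s = of_real (u powr s) * w powr of_real s"
      if "u \<ge> 0" for u s :: real
      using that by (simp add: powr_times_real_left powr_of_real)
    have "linepath 0 w t = of_real t * w" "w - linepath 0 w t = of_real (1 - t) * w"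
      by (simp_all add: linepath_def scaleR_conv_of_real algebra_simps)
    \<comment> \<open>The third factor \<open>w\<close> is the velocity of the segment; it raises
      the exponent \<open>(p - 1) + (q - 1)\<close> by one.\<close>
    moreover have "w powr of_real (p - 1) * w powr of_real (q - 1) * w = ?c"
    proof -
      have "?c = w powr (of_real (p - 1) + of_real (q - 1) + 1)"
        by (simp add: algebra_simps)
      also have "\<dots> = w powr of_real (p - 1) * w powr of_real (q - 1) * w"
        using \<open>w \<noteq> 0\<close> by (simp only: powr_add) simp
      finally show ?thesis ..
    qed
    ultimately show "?c * ?h t = ?g (linepath 0 w t) * (w - 0)"
      using t pw[of t "p - 1"] pw[of "1 - t" "q - 1"]
      by (simp only: flip: \<open>_ = ?c\<close>) (simp add: mult_ac)
  qed
  then show ?thesis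
    by (rule contour_integral_unique)
qed

text \<open>Existence of the extension, which makes the choice in \<open>tremblay\<close>
  meaningful. The integral contributes Beta values, and differentiation turns them into the Gamma
  quotients.\<close>

lemma tremblay_formula_powser:
  fixes b :: "nat \<Rightarrow> complex" and \<tau> \<mu> :: real
  assumes "0 < \<tau>" "0 < \<mu>" "\<tau> - \<mu> < 1"
    and f: "\<And>z. norm z < 1 \<Longrightarrow> (\<lambda>n. b n * z ^ n) sums f z"
  obtains h where "analytic_extension (tremblay_formula \<tau> \<mu> f) h"
    and "\<And>z. norm z < 1 \<Longrightarrow>
      (\<lambda>n. b n * of_real (Gamma \<mu> * Gamma (real n + \<tau>) / (Gamma \<tau> * Gamma (real n + \<mu>))) * z ^ n)
        sums h z"
proof -
  \<comment> \<open>With this \<open>q\<close> the kernel exponent \<open>- (\<tau> - \<mu>)\<close>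
    becomes \<open>q - 1\<close>, and \<open>\<tau> + q - 1 = \<mu>\<close> is the power of
    \<open>w\<close> that comes out of the integral.\<close>
  define q where "q = 1 - (\<tau> - \<mu>)"
  have q: "q > 0" "\<tau> + q = \<mu> + 1" "q - 1 = - (\<tau> - \<mu>)"
    using assms by (auto simp: q_def)
  define J where "J w = integral {0..1}
     (\<lambda>t. of_real (t powr (\<tau> - 1) * (1 - t) powr (q - 1)) * f (of_real t * w))" for w
  define c where "c n = b n * of_real (Beta (\<tau> + real n) q)" for n
  define K where "K = complex_of_real (Gamma \<mu> / Gamma \<tau> / Gamma q)"
  \<comment> \<open>On the slit disc, \<open>(z powr \<mu> * J z)' = z powr (\<mu> - 1) * (\<mu> * J z + z * J' z)\<close>, and the factor
    \<open>z powr (1 - \<mu>)\<close> of the operator cancels the only multivalued term.\<close>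
  define h where "h z = K * (of_real \<mu> * J z + z * deriv J z)" for z
  have J: "(\<lambda>n. c n * w ^ n) sums J w" if "norm w < 1" for w
    unfolding J_def c_def using beta_integral_powser(2)[OF \<open>0 < \<tau>\<close> \<open>q > 0\<close> f that] .
  have J_holo: "J holomorphic_on ball 0 1"
    using J by (intro power_series_holomorphic[of 0 1 c]) auto
  have J_deriv: "(J has_field_derivative deriv J z) (at z)" if "norm z < 1" for z
    using that by (intro holomorphic_derivI[OF J_holo]) auto
  have contour: "contour_integral (linepath 0 w)
      (\<lambda>\<zeta>. \<zeta> powr of_real (\<tau> - 1) * f \<zeta> * (w - \<zeta>) powr of_real (- (\<tau> - \<mu>))) =
      w powr of_real \<mu> * J w" if "norm w < 1" "w \<noteq> 0" for w
    using contour_integral_fractional[OF that(2)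
        beta_integral_powser(1)[OF \<open>0 < \<tau>\<close> \<open>q > 0\<close> f that(1)]] q
    by (simp add: J_def)
  have formula: "tremblay_formula \<tau> \<mu> f z = h z" if z: "norm z < 1" "z \<notin> \<real>\<^sub>\<le>\<^sub>0" for z
  proof -
    have z0: "z \<noteq> 0"
      using z by auto
    have "((\<lambda>w. w powr of_real \<mu> * J w) has_field_derivative
        z powr of_real (\<mu> - 1) * (of_real \<mu> * J z + z * deriv J z)) (at z)"
      using z z0 J_deriv
      by (auto intro!: derivative_eq_intros simp: powr_diff field_simps)
    \<comment> \<open>Comparing derivatives needs the contour formula on a whole neighbourhood of
      \<open>z\<close>, which must avoid 0.\<close>
    moreover have "eventually (\<lambda>w. w \<in> ball 0 1 - {0}) (nhds z)"
      using z z0 by (intro eventually_nhds_in_open) auto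
    then have "eventually (\<lambda>w. contour_integral (linepath 0 w)
      (\<lambda>\<zeta>. \<zeta> powr of_real (\<tau> - 1) * f \<zeta> * (w - \<zeta>) powr of_real (- (\<tau> - \<mu>))) =
      w powr of_real \<mu> * J w) (nhds z)"
      by eventually_elim (intro contour; simp)
    ultimately have "frac_deriv (\<tau> - \<mu>) (\<lambda>\<zeta>. \<zeta> powr of_real (\<tau> - 1) * f \<zeta>) z =
       1 / of_real (Gamma q) * (z powr of_real (\<mu> - 1) * (of_real \<mu> * J z + z * deriv J z))"
      unfolding frac_deriv_def q_def
      by (subst deriv_cong_ev[OF _ refl]) (auto simp: DERIV_imp_deriv)
    moreover have "z powr of_real (1 - \<mu>) * z powr of_real (\<mu> - 1) = 1"
      using z0 by (simp flip: powr_add)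
    ultimately show ?thesis
      by (simp add: tremblay_formula_def h_def K_def mult_ac)
  qed
  have "analytic_extension (tremblay_formula \<tau> \<mu> f) h"
    unfolding analytic_extension_def h_def
    using formula J_holo
    by (auto simp: analytic_on_open h_def intro!: holomorphic_intros)
  moreover have "(\<lambda>n. b n * of_real (Gamma \<mu> * Gamma (real n + \<tau>) / (Gamma \<tau> * Gamma (real n + \<mu>)))
       * z ^ n) sums h z" if z: "norm z < 1" for z
  proof -
    have "(\<lambda>n. K * (of_real \<mu> * (c n * z ^ n) + of_nat n * c n * z ^ n)) sums h z"
      unfolding h_def by (intro sums_mult sums_add J z powser_times_deriv)
    moreover have "K * (of_real \<mu> * (c n * z ^ n) + of_nat n * c n * z ^ n) =
      b n * of_real (Gamma \<mu> * Gamma (real n + \<tau>) / (Gamma \<tau> * Gamma (real n + \<mu>))) * z ^ n" for n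
    proof -
      \<comment> \<open>\<open>Gamma q\<close> from the Beta value cancels the normalization of the
        fractional derivative; the factor \<open>\<mu> + n\<close> left by differentiation cancels
        the one in \<open>Gamma (n + \<mu> + 1) = (n + \<mu>) * Gamma (n + \<mu>)\<close>.\<close>
      have cancel: "x / y / s * m * (g * s / (m * G)) = x * g / (y * G)"
        if "s > 0" "m > 0" for x y s m g G :: real
        using that by (simp add: divide_simps)
      have "real n + \<mu> \<notin> \<int>\<^sub>\<le>\<^sub>0"
        using \<open>\<mu> > 0\<close> by (auto elim!: nonpos_Ints_cases)
      then have "Gamma (real n + \<mu> + 1) = (real n + \<mu>) * Gamma (real n + \<mu>)"
        by (rule Gamma_plus1)
      moreover have arg: "\<tau> + real n + q = real n + \<mu> + 1"
        using q(2) by simp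
      ultimately have "Gamma (\<tau> + real n + q) = (real n + \<mu>) * Gamma (real n + \<mu>)"
        by (simp only: arg)
      then have ratio: "Gamma \<mu> / Gamma \<tau> / Gamma q * (\<mu> + real n) * Beta (\<tau> + real n) q =
          Gamma \<mu> * Gamma (real n + \<tau>) / (Gamma \<tau> * Gamma (real n + \<mu>))"
        using cancel[of "Gamma q" "real n + \<mu>"] q \<open>\<mu> > 0\<close> Gamma_real_pos[of q]
        by (simp add: Beta_def add.commute add_pos_nonneg)
      have "K * (of_real \<mu> + of_nat n) * of_real (Beta (\<tau> + real n) q) =
          of_real (Gamma \<mu> / Gamma \<tau> / Gamma q * (\<mu> + real n) * Beta (\<tau> + real n) q)"
        by (simp add: K_def)
      also note ratio
      finally have coeff: "K * (of_real \<mu> + of_nat n) * of_real (Beta (\<tau> + real n) q) =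
          of_real (Gamma \<mu> * Gamma (real n + \<tau>) / (Gamma \<tau> * Gamma (real n + \<mu>)))" .
      have "K * (of_real \<mu> * (c n * z ^ n) + of_nat n * c n * z ^ n) =
          b n * (K * (of_real \<mu> + of_nat n) * of_real (Beta (\<tau> + real n) q)) * z ^ n"
        by (simp add: c_def algebra_simps)
      then show ?thesis
        by (simp only: coeff)
    qed
    ultimately show ?thesis
      by simp
  qed
  ultimately show thesis
    using that by blast
qed

section \<open>Size of the radius\<close>

text \<open>This crude growth bound suffices for \<open>r\<^sub>3 \<le> 1\<close>: the bases of the powers that define \<open>r\<^sub>3\<close> then
  stay below \<open>1 / (1 - \<gamma>)\<close>.\<close>

lemma Gamma_quotient_le:
  fixes \<tau> \<mu> :: real
  assumes "0 < \<tau>" "\<tau> \<le> 1" "0 < \<mu>" "n \<ge> 1"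
  shows "Gamma (real n + \<tau>) * Gamma (\<mu> + 1) / (Gamma (real n + \<mu>) * Gamma (\<tau> + 1)) \<le> real n"
  using \<open>n \<ge> 1\<close>
proof (induction n rule: dec_induct)
  case base
  show ?case
    using Gamma_real_pos[of "\<tau> + 1"] Gamma_real_pos[of "\<mu> + 1"] assms by (simp add: add.commute)
next
  case (step m)
  let ?B = "\<lambda>n. Gamma (real n + \<tau>) * Gamma (\<mu> + 1) / (Gamma (real n + \<mu>) * Gamma (\<tau> + 1))"
  have rec: "Gamma (real (Suc m) + x) = (real m + x) * Gamma (real m + x)" if "x > 0" for x
  proof -
    have "real m + x \<notin> \<int>\<^sub>\<le>\<^sub>0"
      using that by (auto elim!: nonpos_Ints_cases)
    from Gamma_plus1[OF this] show ?thesis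
      by (simp add: algebra_simps)
  qed
  have "?B (Suc m) = (real m + \<tau>) / (real m + \<mu>) * ?B m"
    using rec[of \<tau>] rec[of \<mu>] assms by simp
  also have "\<dots> \<le> (real m + \<tau>) / (real m + \<mu>) * real m"
    using step assms by (intro mult_left_mono) auto
  also have "\<dots> \<le> real (Suc m)"
  proof -
    have "\<tau> * real m \<le> real m" "0 \<le> \<mu> * real m"
      using assms by (simp_all add: mult_left_le_one_le)
    then have "\<tau> * real m \<le> \<mu> + (real m + \<mu> * real m)"
      using \<open>0 < \<mu>\<close> by linarith
    then have "(real m + \<tau>) * real m \<le> real (Suc m) * (real m + \<mu>)"
      by (simp add: algebra_simps)
    then show ?thesis
      using \<open>0 < \<mu>\<close> by (simp add: divide_simps add_nonneg_pos)
  qed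
  finally show ?case .
qed

lemma radius_r3_le:
  assumes "k + 1 \<le> n"
  shows "radius_r3 \<tau> \<mu> k \<delta> \<gamma> \<alpha> \<le>
    ((1 - \<alpha>) * (1 + \<delta> * real n - \<delta>) * Gamma (real n + \<tau>) * Gamma (\<mu> + 1) /
      (real n * (real n - \<alpha>) * (1 - \<gamma>) * Gamma (real n + \<mu>) * Gamma (\<tau> + 1)))
     powr (1 / (real n - 1))"
  unfolding radius_r3_def using assms by (intro cINF_lower bdd_belowI[of _ 0]) auto

text \<open>Ensures that the disc lies where the power series converges. The infimum is at most each
  term, and the terms of large index are bounded by roots of \<open>1 / (1 - \<gamma>)\<close>,
  which tend to 1.\<close>

lemma radius_r3_le_1:
  assumes "0 < \<tau>" "\<tau> \<le> 1" "0 < \<mu>" "0 \<le> \<delta>" "\<delta> \<le> 1" "\<gamma> < 1" "0 \<le> \<alpha>" "\<alpha> < 1"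
  shows "radius_r3 \<tau> \<mu> k \<delta> \<gamma> \<alpha> \<le> 1"
proof -
  have "radius_r3 \<tau> \<mu> k \<delta> \<gamma> \<alpha> \<le> (1 / (1 - \<gamma>)) powr (inverse (real (Suc m)))" if "m \<ge> k" for m
  proof -
    \<comment> \<open>The shift by 2 turns the exponent \<open>1 / (real n - 1)\<close> into
      \<open>inverse (real (Suc m))\<close> and avoids \<open>n = 1\<close>, where it would be a
      division by zero.\<close>
    define n where "n = Suc m + 1"
    have n: "n \<ge> k + 1" "real n \<ge> 2" "real n - 1 = real (Suc m)"
      using that by (auto simp: n_def)
    define B where "B = Gamma (real n + \<tau>) * Gamma (\<mu> + 1) / (Gamma (real n + \<mu>) * Gamma (\<tau> + 1))"
    define E where "E = (1 - \<alpha>) * (1 + \<delta> * real n - \<delta>) * Gamma (real n + \<tau>) * Gamma (\<mu> + 1) /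
      (real n * (real n - \<alpha>) * (1 - \<gamma>) * Gamma (real n + \<mu>) * Gamma (\<tau> + 1))"
    have E: "E = (1 - \<alpha>) * ((1 + \<delta> * real n - \<delta>) * B) / (real n * (real n - \<alpha>) * (1 - \<gamma>))"
      by (simp add: E_def B_def mult_ac)
    have "0 \<le> B"
      using assms n unfolding B_def
      by (intro divide_nonneg_nonneg mult_nonneg_nonneg Gamma_real_nonneg) auto
    have "0 \<le> \<delta> * (real n - 1)" "\<delta> * (real n - 1) \<le> real n - 1"
      using assms n by (auto intro: mult_left_le_one_le)
    then have d: "0 \<le> 1 + \<delta> * real n - \<delta>" "1 + \<delta> * real n - \<delta> \<le> real n"
      by (simp_all add: algebra_simps)
    \<comment> \<open>Both factors are at most \<open>n\<close>, and the denominator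
      \<open>n * (n - \<alpha>)\<close> absorbs \<open>n * n\<close> because
      \<open>(1 - \<alpha>) * n \<le> n - \<alpha>\<close>.\<close>
    have "(1 + \<delta> * real n - \<delta>) * B \<le> real n * real n"
      using d \<open>0 \<le> B\<close> Gamma_quotient_le[of \<tau> \<mu> n] assms n
      by (intro mult_mono) (auto simp: B_def)
    moreover have "(1 - \<alpha>) * real n \<le> real n - \<alpha>"
    proof -
      have "\<alpha> * 1 \<le> \<alpha> * real n"
        using assms n by (intro mult_left_mono) auto
      then show ?thesis
        by (simp add: algebra_simps)
    qed
    ultimately have "(1 - \<alpha>) * ((1 + \<delta> * real n - \<delta>) * B) \<le> (1 - \<alpha>) * (real n * real n)"
      "(1 - \<alpha>) * real n * real n \<le> (real n - \<alpha>) * real n"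
      using assms by (auto intro: mult_left_mono mult_right_mono)
    then have "(1 - \<alpha>) * ((1 + \<delta> * real n - \<delta>) * B) \<le> real n * (real n - \<alpha>)"
      by (simp add: mult_ac)
    moreover have "0 < real n * (real n - \<alpha>)"
      using assms n by simp
    ultimately have "E \<le> 1 / (1 - \<gamma>)"
      using assms unfolding E by (simp add: divide_simps mult_ac)
    moreover have "0 \<le> E"
      using \<open>0 \<le> B\<close> d assms n unfolding E by (intro divide_nonneg_nonneg mult_nonneg_nonneg) auto
    ultimately have "E powr (1 / (real n - 1)) \<le> (1 / (1 - \<gamma>)) powr (inverse (real (Suc m)))"
      unfolding n(3) by (auto simp: inverse_eq_divide intro: powr_mono2)
    with radius_r3_le[OF n(1), of \<tau> \<mu> \<delta> \<gamma> \<alpha>] show ?thesis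
      unfolding E_def by linarith
  qed
  moreover have "(\<lambda>m. (1 / (1 - \<gamma>)) powr (inverse (real (Suc m)))) \<longlonglongrightarrow> (1 / (1 - \<gamma>)) powr 0"
    using assms by (intro tendsto_powr tendsto_const LIMSEQ_inverse_real_of_nat) auto
  ultimately show ?thesis
    using assms by (intro LIMSEQ_le_const) auto
qed

section \<open>Coefficient inequality for the class\<close>

lemma class_P_coefficients:
  assumes "f \<in> class_P k"
  obtains a :: "nat \<Rightarrow> real" where "\<And>n. a n \<ge> 0" "\<And>n. n \<le> k \<Longrightarrow> a n = 0"
    "\<And>z. norm z < 1 \<Longrightarrow> (\<lambda>n. of_real (a n) * z ^ n) sums (z - f z)"
proof -
  obtain a where a: "\<And>n. n \<ge> k + 1 \<Longrightarrow> a n \<ge> 0"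
    "\<And>z. z \<in> ball 0 1 \<Longrightarrow> (\<lambda>n. of_real (a (n + (k+1))) * z ^ (n + (k+1))) sums (z - f z)"
    using assms unfolding class_P_def by blast
  \<comment> \<open>Membership in \<open>class_P\<close> leaves \<open>a n\<close> arbitrary for
    \<open>n \<le> k\<close>; resetting these values to 0 gives a series indexed from 0.\<close>
  define a' where "a' n = (if n \<le> k then 0 else a n)" for n
  have "(\<lambda>n. of_real (a' n) * z ^ n) sums (z - f z)" if "norm z < 1" for z
  proof -
    have "(\<lambda>n. of_real (a' (n + (k+1))) * z ^ (n + (k+1))) sums (z - f z)"
      using a(2)[of z] that by (simp add: a'_def)
    then have "(\<lambda>n. of_real (a' n) * z ^ n) sums (z - f z + (\<Sum>i<k+1. of_real (a' i) * z ^ i))"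
      by (subst (asm) sums_iff_shift)
    also have "(\<Sum>i<k+1. of_real (a' i) * z ^ i) = 0"
      by (intro sum.neutral) (auto simp: a'_def)
    finally show ?thesis
      by simp
  qed
  with that[of a'] a(1) show thesis
    by (auto simp: a'_def)
qed

text \<open>At a real \<open>x\<close> between 0 and 1 the class condition, multiplied by
  \<open>x\<close>, says that \<open>x\<close> minus the weighted series in \<open>x\<close> exceeds
  \<open>\<gamma> * x\<close>. Nonnegative terms allow passing to partial sums, and then
  \<open>x\<close> tends to 1.\<close>

lemma class_P_tremblay_coefficient_sum:
  fixes a :: "nat \<Rightarrow> real"
  assumes "0 < \<tau>" "0 < \<mu>" "\<tau> - \<mu> < 1" "0 \<le> \<delta>"
    and "f \<in> class_P_tremblay \<tau> \<mu> k \<delta> \<gamma>"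
    and a: "\<And>n. a n \<ge> 0" "a 0 = 0"
    and f: "\<And>z. norm z < 1 \<Longrightarrow> (\<lambda>n. of_real (a n) * z ^ n) sums (z - f z)"
  shows "(\<Sum>n<N. a n * ((1 + \<delta> * real n - \<delta>) *
    (Gamma (real n + \<tau>) * Gamma (\<mu> + 1) / (Gamma (real n + \<mu>) * Gamma (\<tau> + 1))))) \<le> 1 - \<gamma>"
proof -
  define A where "A n = (1 + \<delta> * real n - \<delta>) *
    (Gamma (real n + \<tau>) * Gamma (\<mu> + 1) / (Gamma (real n + \<mu>) * Gamma (\<tau> + 1)))" for n
  define d where "d n = (if n = 1 then 1 else 0) - a n" for n :: nat
  define c where "c n = Gamma \<mu> * Gamma (real n + \<tau>) / (Gamma \<tau> * Gamma (real n + \<mu>))" for n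
  define K where "K = Gamma (\<mu> + 1) * Gamma \<tau> / (Gamma (\<tau> + 1) * Gamma \<mu>)"
  define T where "T = tremblay \<tau> \<mu> f"
  have Gpos: "Gamma \<tau> > 0" "Gamma \<mu> > 0" "Gamma (\<tau> + 1) > 0" "Gamma (\<mu> + 1) > 0"
    using assms by auto
  \<comment> \<open>The constants in the class condition normalize the leading term, so the identity
    part of \<open>f\<close> contributes exactly \<open>x\<close>.\<close>
  have [simp]: "A (Suc 0) = 1"
    using Gpos by (simp add: A_def add.commute)
  have A_nonneg: "a n * A n \<ge> 0" for n
  \<comment> \<open>At \<open>n = 0\<close> the factor \<open>1 - \<delta>\<close> could be negative
    under these hypotheses; there \<open>a 0 = 0\<close> decides.\<close>
  proof (cases "n = 0")
    case False
    then have "0 \<le> \<delta> * (real n - 1)"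
      using assms by (intro mult_nonneg_nonneg) auto
    then have "0 \<le> 1 + \<delta> * real n - \<delta>"
      by (simp add: algebra_simps)
    then show ?thesis
      using assms unfolding A_def
      by (intro divide_nonneg_nonneg mult_nonneg_nonneg Gamma_real_nonneg) auto
  qed (simp add: a)
  have KcA: "K * c n * (1 - \<delta> + \<delta> * real n) = A n" for n
    using Gpos by (simp add: K_def c_def A_def algebra_simps)
  have "(\<lambda>n. of_real (d n) * z ^ n) sums f z" if "norm z < 1" for z
  proof -
    have "(\<lambda>n. if n = 1 then z ^ n else 0) sums z"
      using sums_single[of 1 "\<lambda>n. z ^ n"] by simp
    from sums_diff[OF this f[OF that]] show ?thesis
      by (simp add: d_def if_distrib[of "\<lambda>x. x * _"] left_diff_distrib cong: if_cong)
         (auto simp: if_distrib if_distribR algebra_simps cong: if_cong)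
  qed
  then obtain h where h: "analytic_extension (tremblay_formula \<tau> \<mu> f) h"
    "\<And>z. norm z < 1 \<Longrightarrow> (\<lambda>n. of_real (d n) * of_real (c n) * z ^ n) sums h z"
    using tremblay_formula_powser[of \<tau> \<mu> "\<lambda>n. of_real (d n)" f] assms unfolding c_def by blast
  \<comment> \<open>\<open>h\<close> witnesses the choice, and uniqueness of the extension transfers
    its series to \<open>T\<close>.\<close>
  have T: "analytic_extension (tremblay_formula \<tau> \<mu> f) T"
    unfolding T_def tremblay_def by (rule someI[of "analytic_extension _", OF h(1)])
  have T_sums: "(\<lambda>n. of_real (d n) * of_real (c n) * z ^ n) sums T z" if "norm z < 1" for z
    using analytic_extension_unique[OF h(1) T, of z] h(2)[of z] that by simp
  have T_analytic: "T analytic_on ball 0 1"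
    using T by (simp add: analytic_extension_def)
  have sum_x: "(\<Sum>n<N. a n * A n * x ^ n) \<le> (1 - \<gamma>) * x" if x: "0 < x" "x < 1" for x :: real
  proof -
    define \<Phi> where "\<Phi> w = of_real K * inverse w *
      (of_real (1 - \<delta>) * T w + of_real \<delta> * w * deriv T w)" for w
    \<comment> \<open>At \<open>x > 0\<close> the expression is analytic, so
      \<open>remove_sings\<close> leaves its value unchanged.\<close>
    have "T analytic_on {of_real x}"
      using x by (intro analytic_on_subset[OF T_analytic]) auto
    then have "\<Phi> analytic_on {of_real x}"
      unfolding \<Phi>_def using x by (auto intro!: analytic_intros analytic_deriv)
    then have "Re (\<Phi> (of_real x)) > \<gamma>"
      using assms(5) x unfolding class_P_tremblay_def T_def K_def \<Phi>_def
      by (auto dest!: bspec[of _ _ "of_real x"])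
    let ?x = "complex_of_real x"
    have "(\<lambda>n. of_real K * (of_real (1 - \<delta>) * (of_real (d n) * of_real (c n) * ?x ^ n) +
        of_real \<delta> * (of_nat n * (of_real (d n) * of_real (c n)) * ?x ^ n))) sums
        (of_real K * (of_real (1 - \<delta>) * T ?x + of_real \<delta> * (?x * deriv T ?x)))"
      using x by (intro sums_mult sums_add T_sums powser_times_deriv) auto
    moreover have "of_real K * (of_real (1 - \<delta>) * T ?x + of_real \<delta> * (?x * deriv T ?x)) = ?x * \<Phi> ?x"
      using x by (simp add: \<Phi>_def field_simps)
    moreover have "of_real K * (of_real (1 - \<delta>) * (of_real (d n) * of_real (c n) * ?x ^ n) +
        of_real \<delta> * (of_nat n * (of_real (d n) * of_real (c n)) * ?x ^ n)) =
        of_real (d n * A n * x ^ n)" for n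
      unfolding KcA[symmetric] by (simp add: algebra_simps)
    ultimately have "(\<lambda>n. complex_of_real (d n * A n * x ^ n)) sums (?x * \<Phi> ?x)"
      by simp
    from sums_Re[OF this] have "(\<lambda>n. d n * A n * x ^ n) sums (x * Re (\<Phi> ?x))"
      by simp
    from sums_diff[OF sums_single[of 1 "\<lambda>n. x ^ n"] this]
    have "(\<lambda>n. a n * A n * x ^ n) sums (x - x * Re (\<Phi> ?x))"
      by (rule iffD1[OF arg_cong2[of _ _ _ _ "(sums)"], rotated -1])
         (auto simp: d_def fun_eq_iff algebra_simps)
    moreover have "(\<Sum>n<N. a n * A n * x ^ n) \<le> (\<Sum>n. a n * A n * x ^ n)"
      using x A_nonneg by (intro sum_le_suminf sums_summable[OF calculation]) auto
    ultimately have "(\<Sum>n<N. a n * A n * x ^ n) \<le> x - x * Re (\<Phi> ?x)"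
      by (simp add: sums_iff)
    also have "\<dots> \<le> (1 - \<gamma>) * x"
      using \<open>Re (\<Phi> ?x) > \<gamma>\<close> x by (simp add: algebra_simps)
    finally show ?thesis .
  qed
  \<comment> \<open>A partial sum is a polynomial in \<open>x\<close>, so the limit needs only
    continuity and no Abel-type theorem.\<close>
  have "((\<lambda>x. \<Sum>n<N. a n * A n * x ^ n) \<longlongrightarrow> (\<Sum>n<N. a n * A n * 1 ^ n)) (at_left 1)"
    by (intro tendsto_intros)
  moreover have "((\<lambda>x. (1 - \<gamma>) * x) \<longlongrightarrow> (1 - \<gamma>) * 1) (at_left 1)"
    by (intro tendsto_intros)
  moreover have "eventually (\<lambda>x. x \<in> {0<..<1::real}) (at_left 1)"
    by (rule eventually_at_leftI[of 0]) auto
  then have "eventually (\<lambda>x. (\<Sum>n<N. a n * A n * x ^ n) \<le> (1 - \<gamma>) * x) (at_left 1)"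
    by eventually_elim (use sum_x in auto)
  ultimately have "(\<Sum>n<N. a n * A n * 1 ^ n) \<le> (1 - \<gamma>) * 1"
    by (intro tendsto_le[OF trivial_limit_at_left_real])
  then show ?thesis
    by (simp add: A_def)
qed

section \<open>Convexity from coefficient sums\<close>

text \<open>With \<open>u z = z - f z\<close>, the splitting
  \<open>n * (n - \<alpha>) = n * (n - 1) + (1 - \<alpha>) * n\<close> gives
  \<open>P = S + (1 - \<alpha>) * Q\<close>, where \<open>S\<close> bounds the norm of
  \<open>z ^ 2 * u''\<close> and \<open>Q\<close> that of \<open>z * u'\<close>. The hypothesis on
  \<open>P\<close> then reads \<open>S < (1 - \<alpha>) * (norm z - Q)\<close>, and
  \<open>norm z - Q\<close> is a lower bound for the norm of \<open>z * f'\<close>.\<close>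

lemma convex_of_order_at_if_coefficient_sum:
  fixes a :: "nat \<Rightarrow> real"
  assumes a: "\<And>n. a n \<ge> 0" "a 0 = 0"
    and f: "\<And>z. norm z < 1 \<Longrightarrow> (\<lambda>n. of_real (a n) * z ^ n) sums (z - f z)"
    and z: "norm z < 1" "z \<noteq> 0" and "\<alpha> < 1"
    and P: "(\<lambda>n. real n * (real n - \<alpha>) * a n * norm z ^ n) sums P" "P < (1 - \<alpha>) * norm z"
  shows "deriv f z \<noteq> 0 \<and> Re (1 + z * deriv (deriv f) z / deriv f z) > \<alpha>"
proof -
  define u where "u w = w - f w" for w
  have u: "(\<lambda>n. of_real (a n) * w ^ n) sums u w" if "norm w < 1" for w
    using f[OF that] by (simp add: u_def)
  have u_holo: "u holomorphic_on ball 0 1"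
    using u by (intro power_series_holomorphic[of 0 1 "\<lambda>n. of_real (a n)"]) auto
  have u1: "(\<lambda>n. of_real (real n * a n) * w ^ n) sums (w * deriv u w)" if "norm w < 1" for w
    using powser_times_deriv[OF u that] by simp
  \<comment> \<open>Applying \<open>w * d/dw\<close> twice multiplies the coefficients by
    \<open>n ^ 2\<close>; subtracting the first application leaves the series of
    \<open>z ^ 2 * u''\<close>.\<close>
  have "deriv (\<lambda>w. w * deriv u w) z = deriv u z + z * deriv (deriv u) z"
    using u_holo z
    by (intro DERIV_imp_deriv)
       (auto intro!: derivative_eq_intros holomorphic_derivI[of _ "ball 0 1"] holomorphic_deriv)
  with powser_times_deriv[OF u1 z(1)]
  have "(\<lambda>n. of_real (real n * (real n * a n)) * z ^ n) sums
      (z * (deriv u z + z * deriv (deriv u) z))"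
    by simp
  from sums_diff[OF this u1[OF z(1)]]
  have u2: "(\<lambda>n. of_real (real n * (real n - 1) * a n) * z ^ n) sums (z * (z * deriv (deriv u) z))"
    by (simp add: algebra_simps)
  have n1: "real n * (real n - 1) \<ge> 0" for n
    by (cases n) auto
  have sum1: "summable (\<lambda>n. real n * a n * norm z ^ n)"
    using powser_abs_summable_in_unit_disc[OF u1 z(1)] a
    by (simp add: norm_mult norm_power abs_mult)
  \<comment> \<open>Summability is inherited from the series of \<open>P\<close> by subtracting
    \<open>1 - \<alpha>\<close> times the series in \<open>sum1\<close>.\<close>
  have sum2: "summable (\<lambda>n. real n * (real n - 1) * a n * norm z ^ n)"
    using sums_summable[OF sums_diff[OF P(1) sums_mult[OF summable_sums[OF sum1], of "1 - \<alpha>"]]]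
    by (simp add: algebra_simps)
  define Q where "Q = (\<Sum>n. real n * a n * norm z ^ n)"
  define S where "S = (\<Sum>n. real n * (real n - 1) * a n * norm z ^ n)"
  have "S + (1 - \<alpha>) * Q = P"
  proof -
    have "(\<lambda>n. real n * (real n - 1) * a n * norm z ^ n + (1 - \<alpha>) * (real n * a n * norm z ^ n))
      sums (S + (1 - \<alpha>) * Q)"
      unfolding S_def Q_def by (intro sums_add sums_mult summable_sums sum1 sum2)
    then show ?thesis
      by (intro sums_unique2[OF _ P(1)]) (simp add: algebra_simps)
  qed
  have Q: "norm (z * deriv u z) \<le> Q"
  proof -
    have "norm (\<Sum>n. of_real (real n * a n) * z ^ n) \<le> Q"
      using sum1 a unfolding Q_def
      by (intro norm_suminf_le) (auto simp: norm_mult norm_power abs_mult)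
    with u1[OF z(1)] show ?thesis
      by (simp add: sums_iff)
  qed
  have S: "norm (z * (z * deriv (deriv u) z)) \<le> S"
  proof -
    have "norm (\<Sum>n. of_real (real n * (real n - 1) * a n) * z ^ n) \<le> S"
      unfolding S_def
    proof (intro norm_suminf_le sum2)
      show "norm (of_real (real n * (real n - 1) * a n) * z ^ n) \<le>
          real n * (real n - 1) * a n * norm z ^ n" for n
        unfolding norm_mult norm_of_real norm_power
        using n1[of n] a(1)[of n] by (simp only: abs_of_nonneg mult_nonneg_nonneg order_refl)
    qed
    with u2 show ?thesis
      by (simp add: sums_iff)
  qed
  have deriv_f: "deriv f w = 1 - deriv u w" if "norm w < 1" for w
  proof -
    have "((\<lambda>w. w - u w) has_field_derivative 1 - deriv u w) (at w)"
      using that by (auto intro!: derivative_eq_intros holomorphic_derivI[OF u_holo])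
    then show ?thesis
      by (simp add: u_def DERIV_imp_deriv)
  qed
  have "eventually (\<lambda>w. w \<in> ball 0 1) (nhds z)"
    using z by (intro eventually_nhds_in_open) auto
  then have "eventually (\<lambda>w. deriv f w = 1 - deriv u w) (nhds z)"
    by eventually_elim (simp add: deriv_f)
  then have "deriv (deriv f) z = deriv (\<lambda>w. 1 - deriv u w) z"
    by (rule deriv_cong_ev) simp
  also have "\<dots> = - deriv (deriv u) z"
    using u_holo z
    by (intro DERIV_imp_deriv)
       (auto intro!: derivative_eq_intros holomorphic_derivI[of _ "ball 0 1"] holomorphic_deriv)
  finally have deriv2_f: "deriv (deriv f) z = - deriv (deriv u) z" .
  have "norm z * norm (deriv f z) = norm (z - z * deriv u z)"
    using z by (simp add: deriv_f right_diff_distrib flip: norm_mult)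
  then have lower: "norm z - Q \<le> norm z * norm (deriv f z)"
    using Q norm_triangle_ineq2[of z "z * deriv u z"] by linarith
  have "S < (1 - \<alpha>) * (norm z - Q)"
    using P(2) \<open>S + (1 - \<alpha>) * Q = P\<close> by (simp add: algebra_simps)
  also have "\<dots> \<le> (1 - \<alpha>) * (norm z * norm (deriv f z))"
    using lower \<open>\<alpha> < 1\<close> by (intro mult_left_mono) auto
  finally have "norm z * norm (z * deriv (deriv f) z) < norm z * ((1 - \<alpha>) * norm (deriv f z))"
    using S by (simp add: deriv2_f norm_mult mult_ac)
  then have less: "norm (z * deriv (deriv f) z) < (1 - \<alpha>) * norm (deriv f z)"
    using z by simp
  \<comment> \<open>A vanishing derivative would make the right-hand side 0, which is impossible in
    a strict bound on a norm.\<close>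
  then have nz: "deriv f z \<noteq> 0"
    by auto
  with less have "norm (z * deriv (deriv f) z / deriv f z) < 1 - \<alpha>"
    by (simp add: norm_divide divide_less_eq)
  then have "\<bar>Re (z * deriv (deriv f) z / deriv f z)\<bar> < 1 - \<alpha>"
    using abs_Re_le_cmod le_less_trans by blast
  with nz show ?thesis
    by auto
qed

theorem theorem5:
  fixes k :: nat and \<tau> \<mu> \<delta> \<gamma> \<alpha> :: real and f :: "complex \<Rightarrow> complex"
  assumes "k \<ge> 1"
    and "0 < \<tau>" "\<tau> \<le> 1" "0 < \<mu>" "\<mu> \<le> 1" "0 \<le> \<tau> - \<mu>" "\<tau> - \<mu> < 1"
    and "0 \<le> \<delta>" "\<delta> < 1" "0 \<le> \<gamma>" "\<gamma> < 1" "\<tau> - \<mu> + \<gamma> < 1"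
    and "0 \<le> \<alpha>" "\<alpha> < 1"
    and "f \<in> class_P_tremblay \<tau> \<mu> k \<delta> \<gamma>"
  shows "convex_of_order_in_disc \<alpha> (radius_r3 \<tau> \<mu> k \<delta> \<gamma> \<alpha>) f"
proof -
  have "f \<in> class_P k"
    using assms by (simp add: class_P_tremblay_def)
  then obtain a where a: "\<And>n. a n \<ge> 0" "\<And>n. n \<le> k \<Longrightarrow> a n = 0"
    and f: "\<And>z. norm z < 1 \<Longrightarrow> (\<lambda>n. of_real (a n) * z ^ n) sums (z - f z)"
    by (rule class_P_coefficients) blast
  define R where "R = radius_r3 \<tau> \<mu> k \<delta> \<gamma> \<alpha>"
  define A where "A n = (1 + \<delta> * real n - \<delta>) *
    (Gamma (real n + \<tau>) * Gamma (\<mu> + 1) / (Gamma (real n + \<mu>) * Gamma (\<tau> + 1)))" for n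
  have "R \<le> 1"
    unfolding R_def using assms by (intro radius_r3_le_1) auto
  have A_pos: "A n > 0" if "n > k" for n
  proof -
    have "0 \<le> \<delta> * (real n - 1)"
      using that assms by (intro mult_nonneg_nonneg) auto
    then have "0 < 1 + \<delta> * real n - \<delta>"
      by (simp add: algebra_simps)
    then show ?thesis
      using assms unfolding A_def by (intro divide_pos_pos mult_pos_pos Gamma_real_pos) auto
  qed
  have aA_nonneg: "a n * A n \<ge> 0" for n
    using a A_pos[of n] by (cases "n \<le> k") (auto simp: less_imp_le)
  have sum_le: "(\<Sum>n<N. a n * A n) \<le> 1 - \<gamma>" for N
    unfolding A_def using assms a f by (intro class_P_tremblay_coefficient_sum) auto
  have aA_summable: "summable (\<lambda>n. a n * A n)"
    using aA_nonneg sum_le by (rule summableI_nonneg_bounded)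
  have R_power: "R ^ (n - 1) * (real n * (real n - \<alpha>)) \<le> (1 - \<alpha>) / (1 - \<gamma>) * A n"
    if n: "n > k" and "R > 0" for n
  proof -
    \<comment> \<open>\<open>E\<close> is the base of the power in the term of index
      \<open>n\<close>; raising \<open>R \<le> E powr (1 / (n - 1))\<close> to the power
      \<open>n - 1\<close> undoes the root. Since \<open>k \<ge> 1\<close>, the exponent
      \<open>n - 1\<close> is positive.\<close>
    define E where "E = (1 - \<alpha>) / (1 - \<gamma>) * A n / (real n * (real n - \<alpha>))"
    have n2: "real n > 1"
      using n assms by auto
    have pos: "0 < real n * (real n - \<alpha>)"
      using n2 assms by simp
    then have "E > 0"
      using A_pos[OF n] n2 assms unfolding E_def by (intro divide_pos_pos mult_pos_pos) auto
    have "R \<le> E powr (1 / (real n - 1))"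
      using radius_r3_le[of k n \<tau> \<mu> \<delta> \<gamma> \<alpha>] n unfolding R_def E_def A_def
      by (simp add: mult_ac)
    then have "R ^ (n - 1) \<le> (E powr (1 / (real n - 1))) ^ (n - 1)"
      using \<open>R > 0\<close> by (intro power_mono) auto
    also have "\<dots> = E powr (1 / (real n - 1) * real (n - 1))"
      using \<open>E > 0\<close> by (simp add: powr_powr flip: powr_realpow)
    also have "\<dots> = E"
      using n2 \<open>E > 0\<close> by (simp add: of_nat_diff)
    finally have "R ^ (n - 1) * (real n * (real n - \<alpha>)) \<le> E * (real n * (real n - \<alpha>))"
      using pos by (intro mult_right_mono) auto
    also have "\<dots> = (1 - \<alpha>) / (1 - \<gamma>) * A n"
      using pos by (metis E_def nonzero_divide_eq_eq less_irrefl)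
    finally show ?thesis .
  qed
  show ?thesis
    unfolding convex_of_order_in_disc_def R_def[symmetric]
  proof (intro allI impI)
    fix z :: complex
    assume zR: "norm z < R"
    then have "R > 0" and z: "norm z < 1"
      using \<open>R \<le> 1\<close> norm_ge_zero[of z] by linarith+
    show "deriv f z \<noteq> 0 \<and> Re (1 + z * deriv (deriv f) z / deriv f z) > \<alpha>"
    proof (cases "z = 0")
      case True
      \<comment> \<open>At 0 the strict bound \<open>P < (1 - \<alpha>) * norm z\<close> is
        unattainable, so the centre is treated directly: \<open>k \<ge> 1\<close> gives
        \<open>a 1 = 0\<close>, hence \<open>f\<close> has derivative 1 there.\<close>
      have "((\<lambda>w. w - f w) has_field_derivative deriv (\<lambda>w. w - f w) 0) (at 0)"
        using f by (intro holomorphic_derivI[of _ "ball 0 1"]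
            power_series_holomorphic[of 0 1 "\<lambda>n. of_real (a n)"]) auto
      moreover from termdiffs_sums_strong[OF f this, of 1]
      have "deriv (\<lambda>w. w - f w) 0 = 0"
        using sums_unique2[OF _ powser_sums_zero[of "diffs (\<lambda>n. complex_of_real (a n))"]] a(2)[of 1] assms
        by (auto simp: diffs_def)
      ultimately have "((\<lambda>w. w - (w - f w)) has_field_derivative 1 - 0) (at 0)"
        by (intro derivative_intros) simp
      then have "deriv f 0 = 1"
        by (simp add: DERIV_imp_deriv)
      with True assms show ?thesis
        by simp
    next
      case False
      define r where "r = norm z"
      \<comment> \<open>\<open>C\<close> combines
        \<open>r ^ n \<le> r * (r / R) * R ^ (n - 1)\<close> with \<open>R_power\<close>. Multiplied
        by the bound \<open>1 - \<gamma>\<close> on the coefficient sum it becomes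
        \<open>(1 - \<alpha>) * r * (r / R)\<close>.\<close>
      define C where "C = r * (r / R) * ((1 - \<alpha>) / (1 - \<gamma>))"
      have r: "0 < r" "r < R"
        using zR False by (auto simp: r_def)
      have C: "C \<ge> 0"
        using r \<open>R > 0\<close> assms by (simp add: C_def)
      have nonneg: "real n * (real n - \<alpha>) * a n * r ^ n \<ge> 0" for n
        using a(1) r assms by (cases "n = 0") auto
      have le: "real n * (real n - \<alpha>) * a n * r ^ n \<le> C * (a n * A n)" for n
      proof (cases "n \<le> k")
        case False
        \<comment> \<open>Here \<open>n > k \<ge> 1\<close>, so the exponent \<open>n - 1\<close> is
          at least 1 and one factor \<open>r / R\<close> can be split off.\<close>
        then obtain m where m: "n = Suc (Suc m)"
          using assms by (metis Suc_le_D not_less_eq_eq One_nat_def)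
        \<comment> \<open>The spare factor \<open>r / R < 1\<close> makes the final inequality strict.\<close>
        have "r ^ (n - 1) = (r / R) * (r / R) ^ m * R ^ (n - 1)"
          using \<open>R > 0\<close> by (simp add: m power_divide)
        also have "\<dots> \<le> (r / R) * 1 * R ^ (n - 1)"
          using r \<open>R > 0\<close> by (intro mult_right_mono mult_left_mono power_le_one) auto
        finally have "r ^ n \<le> r * (r / R) * R ^ (n - 1)"
          using r by (simp add: m mult_ac)
        then have "real n * (real n - \<alpha>) * a n * r ^ n \<le>
          real n * (real n - \<alpha>) * a n * (r * (r / R) * R ^ (n - 1))"
          using m a(1) assms by (intro mult_left_mono) auto
        also have "\<dots> = r * (r / R) * a n * (R ^ (n - 1) * (real n * (real n - \<alpha>)))"
          by (simp add: mult_ac)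
        also have "\<dots> \<le> r * (r / R) * a n * ((1 - \<alpha>) / (1 - \<gamma>) * A n)"
          using False a(1) r \<open>R > 0\<close> by (intro mult_left_mono R_power) auto
        finally show ?thesis
          by (simp add: C_def mult_ac)
      qed (simp add: a)
      have sm: "summable (\<lambda>n. real n * (real n - \<alpha>) * a n * r ^ n)"
        using nonneg le by (intro summable_comparison_test'[OF summable_mult[OF aA_summable, of C]]) auto
      have "(\<Sum>n. real n * (real n - \<alpha>) * a n * r ^ n) \<le> (\<Sum>n. C * (a n * A n))"
        by (intro suminf_le le sm summable_mult aA_summable)
      also have "\<dots> = C * (\<Sum>n. a n * A n)"
        by (rule suminf_mult[OF aA_summable])
      also have "\<dots> \<le> C * (1 - \<gamma>)"
        using C sum_le by (intro mult_left_mono suminf_le_const aA_summable)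
      also have "\<dots> = (1 - \<alpha>) * r * (r / R)"
        using assms by (simp add: C_def)
      also have "\<dots> < (1 - \<alpha>) * r"
      proof -
        have "0 < (1 - \<alpha>) * r" "r / R < 1"
          using r \<open>R > 0\<close> assms by simp_all
        then show ?thesis
          using mult_strict_left_mono by fastforce
      qed
      finally show ?thesis
        using a f z False assms(14) summable_sums[OF sm] unfolding r_def
        by (intro convex_of_order_at_if_coefficient_sum) auto
    qed
  qed
qed

end
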